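(* Let $\alpha_1,\alpha_2,\beta_1\in\mathbb{C}$ with $\Re(\beta_1)>\Re(\alpha_2)>0$, and suppose that either $\Re(b)>0$ and $\Re(d)>0$, or $b=d=0$. Then for $z\in\mathbb{C}$ with $|\arg(1-z)|<\pi$, $$ {}_{2}F_{1}^{(\kappa_l)}\left[\begin{array}{c}\alpha_1,\alpha_2\\ \beta_1\end{array};z;b,d\right]=\frac{1}{B(\alpha_2,\beta_1-\alpha_2)}\int_0^1 t^{\alpha_2-1}(1-t)^{\beta_1-\alpha_2-1}(1-zt)^{-\alpha_1}\,\Theta\left(-\frac{b}{t}-\frac{d}{1-t}\right)dt , $$ where the left side is the defining series for $|z|<1$ and its analytic continuation otherwise.
   Context: Here $(a)_m=\Gamma(a+m)/\Gamma(a)$ is the Pochhammer symbol and $B(\cdot,\cdot)$ is Euler's beta function; powers are principal. Let $\{\kappa_l\}_{l\ge0}$ be a complex sequence with $\kappa_0=1$ and let $\Theta(z)=\Theta(\kappa_l;z)$ be a function analytic in a disk $|z|<R$ ($0<R<\infty$) with $\Theta(z)=\sum_{l\ge0}\kappa_l z^l/l!$ there, continued analytically to the half-plane $\Re(z)>0$ with $\Theta(z)=M_0z^{\omega}e^{z}[1+O(1/z)]$ as $\Re(z)\to\infty$ ($M_0>0$, $\omega\in\mathbb{C}$). It is also understood that $\Theta$ is defined and continuous on $\Re(z)\le 0$ and that the following integrals converge absolutely. For $\Re(b),\Re(d)\ge0$ and $\Re(\alpha),\Re(\beta)>0$ the extended beta function is $$\mathcal{B}^{(\kappa_l)}_{b,d}(\alpha,\beta)=\int_0^1t^{\alpha-1}(1-t)^{\beta-1}\Theta\left(-\frac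 bt-\frac d{1-t}\right)dt .$$ The extended Gauss hypergeometric function is, for $|z|<1$ and $\Re(\beta_1)>\Re(\alpha_2)>0$, $${}_{2}F_{1}^{(\kappa_l)}\left[\begin{array}{c}\alpha_1,\alpha_2\\ \beta_1\end{array};z;b,d\right]=\sum_{n=0}^\infty(\alpha_1)_n\frac{\mathcal{B}^{(\kappa_l)}_{b,d}(\alpha_2+n,\beta_1-\alpha_2)}{B(\alpha_2,\beta_1-\alpha_2)}\frac{z^n}{n!}.$$ *)

theory Defs
  imports "HOL-Complex_Analysis.Complex_Analysis" "HOL-Library.Landau_Symbols"
begin

definition ext_beta_integrand ::
  "(complex \<Rightarrow> complex) \<Rightarrow> complex \<Rightarrow> complex \<Rightarrow> complex \<Rightarrow> complex \<Rightarrow> real \<Rightarrow> complex" where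
  "ext_beta_integrand \<Theta> b d \<alpha> \<beta> t =
     of_real t powr (\<alpha> - 1) * of_real (1 - t) powr (\<beta> - 1) * \<Theta> (- b / of_real t - d / of_real (1 - t))"

definition ext_beta ::
  "(complex \<Rightarrow> complex) \<Rightarrow> complex \<Rightarrow> complex \<Rightarrow> complex \<Rightarrow> complex \<Rightarrow> complex" where
  "ext_beta \<Theta> b d \<alpha> \<beta> = (LBINT t:{0<..<1}. ext_beta_integrand \<Theta> b d \<alpha> \<beta> t)"

text \<open>\<open>pochhammer\<close> is the rising factorial, which is the continuous extension of
  \<open>\<Gamma>(a + n) / \<Gamma>(a)\<close> to those \<open>a\<close> that are non-positive integers.\<close>

definition ext_2F1_term ::
  "(complex \<Rightarrow> complex) \<Rightarrow> complex \<Rightarrow> complex \<Rightarrow> complex \<Rightarrow> complex \<Rightarrow> complex \<Rightarrow> complex \<Rightarrow> nat \<Rightarrow> complex" where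
  "ext_2F1_term \<Theta> \<alpha>1 \<alpha>2 \<beta>1 b d z n =
     pochhammer \<alpha>1 n * (ext_beta \<Theta> b d (\<alpha>2 + of_nat n) (\<beta>1 - \<alpha>2) / Beta \<alpha>2 (\<beta>1 - \<alpha>2)) * (z ^ n / fact n)"

definition ext_2F1_series ::
  "(complex \<Rightarrow> complex) \<Rightarrow> complex \<Rightarrow> complex \<Rightarrow> complex \<Rightarrow> complex \<Rightarrow> complex \<Rightarrow> complex \<Rightarrow> complex" where
  "ext_2F1_series \<Theta> \<alpha>1 \<alpha>2 \<beta>1 b d z = (\<Sum>n. ext_2F1_term \<Theta> \<alpha>1 \<alpha>2 \<beta>1 b d z n)"

text \<open>The point \<open>z = 1\<close> has to be excluded explicitly, because \<open>Arg 0 = 0\<close> by convention.\<close>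

definition cut_plane :: "complex set" where
  "cut_plane = {z. 1 - z \<noteq> 0 \<and> \<bar>Arg (1 - z)\<bar> < pi}"

text \<open>The cut plane is open, connected and contains the unit disk, so the series has at most one
  analytic continuation to it and the description below is unique as soon as one exists.\<close>

definition ext_2F1 ::
  "(complex \<Rightarrow> complex) \<Rightarrow> complex \<Rightarrow> complex \<Rightarrow> complex \<Rightarrow> complex \<Rightarrow> complex \<Rightarrow> complex \<Rightarrow> complex" where
  "ext_2F1 \<Theta> \<alpha>1 \<alpha>2 \<beta>1 b d z =
     (if norm z < 1 then ext_2F1_series \<Theta> \<alpha>1 \<alpha>2 \<beta>1 b d z
      else (THE w. \<exists>f. f analytic_on cut_plane \<and>
                       (\<forall>\<zeta>. norm \<zeta> < 1 \<longrightarrow> f \<zeta> = ext_2F1_series \<Theta> \<alpha>1 \<alpha>2 \<beta>1 b d \<zeta>) \<and>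
                       w = f z))"

definition euler_integrand ::
  "(complex \<Rightarrow> complex) \<Rightarrow> complex \<Rightarrow> complex \<Rightarrow> complex \<Rightarrow> complex \<Rightarrow> complex \<Rightarrow> complex \<Rightarrow> real \<Rightarrow> complex" where
  "euler_integrand \<Theta> \<alpha>1 \<alpha>2 \<beta>1 b d z t =
     of_real t powr (\<alpha>2 - 1) * of_real (1 - t) powr (\<beta>1 - \<alpha>2 - 1) * (1 - z * of_real t) powr (- \<alpha>1) *
     \<Theta> (- b / of_real t - d / of_real (1 - t))"

end

theory Submission
  imports Defs
begin

text \<open>Expanding \<open>(1 - zt)\<close> to the power \<open>-\<alpha>1\<close> in the binomial series and integrating term by term
  identifies the series with the Euler integral on the unit disk; the absolute integrability of the
  extended beta integrand for \<open>n = 0\<close> is enough to justify this. On compact subsets of the cut plane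
  the kernel and its \<open>z\<close>-derivative are bounded uniformly in \<open>t\<close>, so the integral is holomorphic
  there, and the identity theorem makes it the continuation of the series.\<close>

section \<open>Differentiation under the integral sign\<close>

text \<open>Dominated convergence, applied to the difference quotients of \<open>K\<close>: the mean value inequality
  on the ball bounds them by \<open>B\<close>.\<close>

lemma has_field_derivative_integral_kernel:
  fixes g :: "'a \<Rightarrow> complex" and K K' :: "complex \<Rightarrow> 'a \<Rightarrow> complex"
  assumes r: "r > 0"
    and g: "integrable M g"
    and gK: "\<And>w. w \<in> ball z r \<Longrightarrow> integrable M (\<lambda>t. g t * K w t)"
    and K'_meas [measurable]: "K' z \<in> borel_measurable M"
    and deriv: "\<And>w t. w \<in> ball z r \<Longrightarrow> t \<in> space M \<Longrightarrow>
                  ((\<lambda>u. K u t) has_field_derivative K' w t) (at w)"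
    and bound: "\<And>w t. w \<in> ball z r \<Longrightarrow> t \<in> space M \<Longrightarrow> norm (K' w t) \<le> B"
  shows "((\<lambda>w. \<integral>t. g t * K w t \<partial>M) has_field_derivative (\<integral>t. g t * K' z t \<partial>M)) (at z)"
proof -
  let ?F = "\<lambda>w. \<integral>t. g t * K w t \<partial>M"
  note [measurable] = borel_measurable_integrable[OF g]
  have z: "z \<in> ball z r" using r by simp
  \<comment> \<open>Dominated convergence speaks about sequences, so the limit is tested along an
    arbitrary sequence tending to \<open>z\<close>. Taking it within the ball keeps every
    \<open>X i\<close> where the assumptions on \<open>K\<close> apply.\<close>
  have "((\<lambda>w. (?F w - ?F z) / (w - z)) \<longlongrightarrow> (\<integral>t. g t * K' z t \<partial>M)) (at z within ball z r)"
    unfolding tendsto_at_iff_sequentially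
  proof (intro allI impI)
    fix X assume "\<forall>i. X i \<in> ball z r - {z}" and lim: "X \<longlonglongrightarrow> z"
    then have X: "X i \<in> ball z r" "X i \<noteq> z" for i by auto
    let ?s = "\<lambda>i t. (g t * K (X i) t - g t * K z t) / (X i - z)"
    have "(\<lambda>i. \<integral>t. ?s i t \<partial>M) \<longlonglongrightarrow> (\<integral>t. g t * K' z t \<partial>M)"
    proof (rule integral_dominated_convergence[where w = "\<lambda>t. norm (g t) * B"])
      show "(\<lambda>t. g t * K' z t) \<in> borel_measurable M" by measurable
      show "?s i \<in> borel_measurable M" for i
        using gK[OF X(1), of i] gK[OF z] by (intro borel_measurable_integrable) simp
      show "integrable M (\<lambda>t. norm (g t) * B)" using g by simp
      show "AE t in M. (\<lambda>i. ?s i t) \<longlonglongrightarrow> g t * K' z t"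
      proof (rule AE_I2)
        fix t assume t: "t \<in> space M"
        have "filterlim X (at z) sequentially"
          using lim X(2) by (auto simp: filterlim_at)
        then have "(\<lambda>i. (K (X i) t - K z t) / (X i - z)) \<longlonglongrightarrow> K' z t"
          using deriv[OF z t] unfolding has_field_derivative_iff
          by (rule filterlim_compose[rotated])
        then have "(\<lambda>i. g t * ((K (X i) t - K z t) / (X i - z))) \<longlonglongrightarrow> g t * K' z t"
          by (rule tendsto_mult_left)
        then show "(\<lambda>i. ?s i t) \<longlonglongrightarrow> g t * K' z t"
          by (simp add: right_diff_distrib)
      qed
      show "AE t in M. norm (?s i t) \<le> norm (g t) * B" for i
      proof (rule AE_I2)
        fix t assume t: "t \<in> space M"
        have "norm (K (X i) t - K z t) \<le> B * norm (X i - z)"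
          using X(1)[of i] z t deriv bound
          by (intro field_differentiable_bound[of "ball z r" _ "\<lambda>w. K' w t"])
            (auto intro: has_field_derivative_at_within)
        then have "norm (g t) * (norm (K (X i) t - K z t) / norm (X i - z)) \<le> norm (g t) * B"
          using X(2)[of i] by (intro mult_left_mono) (auto simp: field_simps)
        then show "norm (?s i t) \<le> norm (g t) * B"
          by (simp add: norm_mult norm_divide flip: right_diff_distrib)
      qed
    qed
    moreover have "(\<integral>t. ?s i t \<partial>M) = (?F (X i) - ?F z) / (X i - z)" for i
      using Bochner_Integration.integral_diff[OF gK[OF X(1), of i] gK[OF z]] by simp
    ultimately show "((\<lambda>w. (?F w - ?F z) / (w - z)) \<circ> X) \<longlonglongrightarrow> (\<integral>t. g t * K' z t \<partial>M)"
      by (simp only: comp_def)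
  qed
  then have "(?F has_field_derivative (\<integral>t. g t * K' z t \<partial>M)) (at z within ball z r)"
    by (simp add: has_field_derivative_iff)
  then show ?thesis using r by (simp add: at_within_open[OF z])
qed

section \<open>Geometry of the cut plane\<close>

text \<open>\<open>Arg\<close> takes values in (-pi, pi] and equals pi exactly on the negative
  reals; the point 0 is removed separately. The slit form matches the domain on which
  \<open>powr\<close> is differentiable in its base.\<close>

lemma mem_cut_plane_iff: "z \<in> cut_plane \<longleftrightarrow> 1 - z \<notin> \<real>\<^sub>\<le>\<^sub>0"
proof -
  have "w \<noteq> 0 \<and> \<bar>Arg w\<bar> < pi \<longleftrightarrow> w \<notin> \<real>\<^sub>\<le>\<^sub>0" for w
  proof -
    have "\<bar>Arg w\<bar> < pi \<longleftrightarrow> Arg w \<noteq> pi"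
      using Arg_le_pi[of w] mpi_less_Arg[of w] by linarith
    then show ?thesis
      using Arg_eq_pi[of w] by (auto simp: complex_nonpos_Reals_iff complex_eq_iff)
  qed
  then show ?thesis unfolding cut_plane_def by blast
qed

text \<open>Connectedness passes to continuous images, so for that purpose the cut plane is written
  as an image of the slit plane rather than as a preimage.\<close>

lemma cut_plane_altdef: "cut_plane = (\<lambda>w. 1 - w) ` (- \<real>\<^sub>\<le>\<^sub>0)"
proof (rule set_eqI)
  fix z :: complex
  show "z \<in> cut_plane \<longleftrightarrow> z \<in> (\<lambda>w. 1 - w) ` (- \<real>\<^sub>\<le>\<^sub>0)"
    using image_eqI[of z "\<lambda>w. 1 - w" "1 - z"] by (auto simp: mem_cut_plane_iff)
qed

lemma open_cut_plane: "open cut_plane"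
proof -
  have "open ((\<lambda>z. 1 - z) -` (- \<real>\<^sub>\<le>\<^sub>0 :: complex set))"
    by (intro open_vimage continuous_intros open_Compl closed_nonpos_Reals_complex)
  also have "(\<lambda>z. 1 - z) -` (- \<real>\<^sub>\<le>\<^sub>0) = cut_plane"
    by (auto simp: mem_cut_plane_iff)
  finally show ?thesis .
qed

lemma connected_cut_plane: "connected cut_plane"
proof -
  have "connected (- \<real>\<^sub>\<le>\<^sub>0 :: complex set)"
    using simply_connected_imp_connected[OF simply_connected_slotted_complex_plane_left[of 0]]
    by (simp add: nonpos_Reals_def setcompr_eq_image atMost_def)
  then show ?thesis
    unfolding cut_plane_altdef by (intro connected_continuous_image continuous_intros)
qed

text \<open>If \<open>1 - z * of_real t\<close> met the slit, then \<open>z\<close> would be real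
  with z >= zt >= 1, hence on the cut itself. Both endpoints of the t-interval are allowed, which
  makes compactness in \<open>t\<close> available later.\<close>

lemma one_minus_mult_notin_nonpos_Reals:
  assumes "z \<in> cut_plane" "0 \<le> t" "t \<le> 1"
  shows "1 - z * of_real t \<notin> \<real>\<^sub>\<le>\<^sub>0"
proof
  assume *: "1 - z * of_real t \<in> \<real>\<^sub>\<le>\<^sub>0"
  \<comment> \<open>At t = 0 the expression is 1, off the slit; for nonzero t the imaginary part of
    the product vanishes only if that of \<open>z\<close> does.\<close>
  have "t \<noteq> 0" using * by auto
  with * have "Im z = 0" and 1: "Re z * t \<ge> 1"
    by (auto simp: complex_nonpos_Reals_iff)
  moreover from 1 assms(2) have "Re z > 0"
    using mult_nonpos_nonneg[of "Re z" t] by (cases "Re z > 0") auto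
  then have "Re z * t \<le> Re z"
    using assms by (simp add: mult_left_le)
  ultimately show False
    using 1 assms(1) by (simp add: mem_cut_plane_iff complex_nonpos_Reals_iff)
qed

lemma unit_ball_subset_cut_plane: "ball 0 1 \<subseteq> cut_plane"
proof
  fix z :: complex assume "z \<in> ball 0 1"
  then have "Re z < 1" using complex_Re_le_cmod[of z] by simp
  then show "z \<in> cut_plane" by (simp add: mem_cut_plane_iff complex_nonpos_Reals_iff)
qed

section \<open>The kernel (1 - zt)^s and its binomial series\<close>

text \<open>Continuity is joint in both variables, so that on a compact set of \<open>w\<close> the
  kernel has a bound uniform in \<open>t\<close>.\<close>

lemma continuous_on_euler_kernel:
  "continuous_on (cut_plane \<times> {0..1}) (\<lambda>(w, t). (1 - w * of_real t) powr s)"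
proof -
  have "continuous_on (- \<real>\<^sub>\<le>\<^sub>0) (\<lambda>u :: complex. u powr s)"
    using has_field_derivative_powr[of _ s] DERIV_isCont
    by (intro continuous_at_imp_continuous_on) blast
  moreover have "continuous_on (cut_plane \<times> {0..1})
      (\<lambda>p. 1 - fst p * of_real (snd p) :: complex)"
    by (intro continuous_intros)
  moreover have "(\<lambda>p. 1 - fst p * of_real (snd p)) ` (cut_plane \<times> {0..1}) \<subseteq> - \<real>\<^sub>\<le>\<^sub>0"
    using one_minus_mult_notin_nonpos_Reals by auto
  ultimately show ?thesis
    unfolding case_prod_beta by (rule continuous_on_compose2)
qed

lemma continuous_on_euler_kernel_real:
  assumes "z \<in> cut_plane"
  shows "continuous_on {0..1} (\<lambda>t. (1 - z * of_real t) powr s)"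
proof -
  have "continuous_on {0..1} (Pair z)"
    by (intro continuous_intros)
  from continuous_on_compose2[OF continuous_on_euler_kernel[of s] this] show ?thesis
    using assms by auto
qed

lemma has_field_derivative_euler_kernel:
  assumes "w \<in> cut_plane" "t \<in> {0..1}"
  shows "((\<lambda>w. (1 - w * of_real t) powr s) has_field_derivative
           - s * of_real t * (1 - w * of_real t) powr (s - 1)) (at w)"
  using one_minus_mult_notin_nonpos_Reals[of w t] assms
  by (auto intro!: derivative_eq_intros)

lemma sums_one_minus_powr:
  fixes z a :: complex
  assumes "norm z < 1"
  shows "(\<lambda>n. pochhammer a n / fact n * z ^ n) sums (1 - z) powr (- a)"
proof -
  \<comment> \<open>One sign comes from rewriting the binomial coefficient of \<open>- a\<close> as
    a Pochhammer symbol, the other from the n-th power of \<open>- z\<close>; they cancel.\<close>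
  have "(-1) ^ n * (-1) ^ n = (1 :: complex)" for n
    by (simp flip: power_mult_distrib)
  then have "((- a) gchoose n) * (- z) ^ n = pochhammer a n / fact n * z ^ n" for n
    by (simp add: gbinomial_pochhammer power_minus[of z] mult_ac)
  then show ?thesis
    using gen_binomial_complex[of "- z" "- a"] assms by simp
qed

text \<open>The series converges at a real point \<open>r\<close> strictly between
  \<open>norm z\<close> and 1, and a power series converges absolutely at every point of smaller
  modulus.\<close>

lemma summable_norm_one_minus_powr:
  fixes z a :: complex
  assumes "norm z < 1"
  shows "summable (\<lambda>n. norm (pochhammer a n / fact n * z ^ n))"
proof -
  obtain r where r: "norm z < r" "r < 1" using dense assms by blast
  then have "norm (of_real r :: complex) < 1" using norm_ge_zero[of z] by (simp del: norm_ge_zero)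
  then show ?thesis
    using powser_insidea[OF sums_summable[OF sums_one_minus_powr[of "of_real r" a]], of z] r
    by simp
qed


section \<open>Integrals against the kernel: integrability, holomorphy, expansion\<close>

text \<open>Any singular behaviour at the endpoints of (0,1) sits in \<open>g\<close>. The kernel
  extends continuously to [0,1], so each claim follows by domination with a constant multiple of
  \<open>norm (g t)\<close>.\<close>

lemma
  fixes g :: "real \<Rightarrow> complex"
  defines "M \<equiv> restrict_space lborel {0<..<1}"
  assumes g: "integrable M g"
  shows integrable_mult_euler_kernel:
      "z \<in> cut_plane \<Longrightarrow> integrable M (\<lambda>t. g t * (1 - z * of_real t) powr s)"
    and holomorphic_on_euler_integral:
      "(\<lambda>z. \<integral>t. g t * (1 - z * of_real t) powr s \<partial>M) holomorphic_on cut_plane"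
    and sums_euler_integral:
      "norm z < 1 \<Longrightarrow> (\<lambda>n. pochhammer a n / fact n * z ^ n * (\<integral>t. of_real t ^ n * g t \<partial>M)) sums
         (\<integral>t. g t * (1 - z * of_real t) powr (- a) \<partial>M)"
proof -
  have space_M: "space M = {0<..<1}"
    by (simp add: M_def space_restrict_space)
  have sets_M: "sets M = sets (restrict_space borel {0<..<1})"
    unfolding M_def by (intro sets_restrict_space_cong) simp
  \<comment> \<open>Up to the choice of sigma-algebra, \<open>M\<close> carries the Borel sets of
    the open interval, so continuity on [0,1] yields measurability.\<close>
  have meas: "f \<in> borel_measurable M" if "continuous_on {0..1} f" for f :: "real \<Rightarrow> complex"
    unfolding measurable_cong_sets[OF sets_M refl]
    by (intro borel_measurable_continuous_on_restrict continuous_on_subset[OF that]) auto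
  note [measurable] = borel_measurable_integrable[OF g]
  show int: "integrable M (\<lambda>t. g t * (1 - z * of_real t) powr s)" if z: "z \<in> cut_plane" for z s
  proof -
    note cont = continuous_on_euler_kernel_real[OF z, of s]
    note [measurable] = meas[OF cont]
    obtain B where B: "norm ((1 - z * of_real t) powr s) \<le> B" if "t \<in> {0..1}" for t
      using compact_imp_bounded[OF compact_continuous_image[OF cont]] unfolding bounded_iff by blast
    show ?thesis
    proof (rule Bochner_Integration.integrable_bound)
      show "integrable M (\<lambda>t. norm (g t) * B)" using g by simp
      show "AE t in M. norm (g t * (1 - z * of_real t) powr s) \<le> norm (norm (g t) * B)"
      proof (rule AE_I2)
        fix t assume "t \<in> space M"
        then have "norm ((1 - z * of_real t) powr s) \<le> \<bar>B\<bar>"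
          using B[of t] by (auto simp: space_M)
        then show "norm (g t * (1 - z * of_real t) powr s) \<le> norm (norm (g t) * B)"
          by (simp add: norm_mult abs_mult mult_left_mono)
      qed
    qed measurable
  qed
  show "(\<lambda>z. \<integral>t. g t * (1 - z * of_real t) powr s \<partial>M) holomorphic_on cut_plane"
    unfolding holomorphic_on_open[OF open_cut_plane]
  proof
    fix z assume z: "z \<in> cut_plane"
    \<comment> \<open>A closed ball is chosen so that its product with [0,1] is compact; the
      continuous \<open>?K'\<close> then has a bound \<open>B\<close> independent of
      \<open>w\<close> and \<open>t\<close>.\<close>
    obtain r where r: "r > 0" "cball z r \<subseteq> cut_plane"
      using z open_cut_plane open_contains_cball by blast
    let ?K' = "\<lambda>w t. - s * of_real t * (1 - w * of_real t) powr (s - 1)"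
    have "continuous_on (cball z r \<times> {0..1}) (\<lambda>(w, t). (1 - w * of_real t) powr (s - 1))"
      by (rule continuous_on_subset[OF continuous_on_euler_kernel]) (use r in auto)
    then have "continuous_on (cball z r \<times> {0..1}) (\<lambda>(w, t). ?K' w t)"
      unfolding case_prod_beta by (rule continuous_on_mult[rotated]) (intro continuous_intros)
    then have "compact ((\<lambda>(w, t). ?K' w t) ` (cball z r \<times> {0..1}))"
      by (intro compact_continuous_image compact_Times) auto
    from compact_imp_bounded[OF this]
    obtain B where B: "norm (?K' w t) \<le> B" if "w \<in> cball z r" "t \<in> {0..1}" for w t
      unfolding bounded_iff by fastforce
    have "((\<lambda>z. \<integral>t. g t * (1 - z * of_real t) powr s \<partial>M) has_field_derivative
            (\<integral>t. g t * ?K' z t \<partial>M)) (at z)"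
    proof (rule has_field_derivative_integral_kernel[OF r(1) g])
      fix w t assume w: "w \<in> ball z r" and t: "t \<in> space M"
      then show "norm (?K' w t) \<le> B" by (intro B) (auto simp: space_M)
      show "((\<lambda>w. (1 - w * of_real t) powr s) has_field_derivative ?K' w t) (at w)"
        using w t r by (intro has_field_derivative_euler_kernel) (auto simp: space_M)
    next
      show "?K' z \<in> borel_measurable M"
        by (intro meas continuous_intros continuous_on_euler_kernel_real z)
      show "integrable M (\<lambda>t. g t * (1 - w * of_real t) powr s)" if "w \<in> ball z r" for w
        using that r by (intro int) auto
    qed
    then show "\<exists>F'. ((\<lambda>z. \<integral>t. g t * (1 - z * of_real t) powr s \<partial>M) has_field_derivative F') (at z)"
      by blast
  qed
  show "(\<lambda>n. pochhammer a n / fact n * z ^ n * (\<integral>t. of_real t ^ n * g t \<partial>M)) sums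
         (\<integral>t. g t * (1 - z * of_real t) powr (- a) \<partial>M)" if z: "norm z < 1"
  proof -
    let ?c = "\<lambda>n. pochhammer a n / fact n * z ^ n"
    let ?f = "\<lambda>n t. ?c n * (of_real t ^ n * g t)"
    have [measurable]: "(\<lambda>t. of_real t ^ n :: complex) \<in> borel_measurable M" for n
      by (intro meas continuous_intros)
    \<comment> \<open>Since 0 < t < 1, the powers of \<open>t\<close> have modulus at most 1, so
      \<open>g\<close> dominates all of its moment integrands at once.\<close>
    have bound: "norm (of_real t ^ n * g t) \<le> norm (g t)" if "t \<in> space M" for t n
      using that by (auto simp: norm_mult norm_power space_M intro!: mult_left_le_one_le power_le_one)
    have int': "integrable M (\<lambda>t. of_real t ^ n * g t)" for n
      by (rule Bochner_Integration.integrable_bound[OF g]) (use bound in auto)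
    have bound': "norm (?f n t) \<le> norm (?c n) * norm (g t)" if "t \<in> space M" for n t
      unfolding norm_mult[of "?c n"] using bound[OF that] by (intro mult_left_mono) auto
    \<comment> \<open>The interchange of sum and integral has two summability conditions.
      \<open>C\<close> is \<open>norm (g t)\<close> for the pointwise one and the integral of
      \<open>norm (g t)\<close> for the one on integrals.\<close>
    have sum_c: "summable (\<lambda>n. norm (?c n) * C)" for C
      by (intro summable_mult2 summable_norm_one_minus_powr z)
    have "(\<lambda>n. \<integral>t. ?f n t \<partial>M) sums (\<integral>t. (\<Sum>n. ?f n t) \<partial>M)"
    proof (rule sums_integral)
      show "integrable M (?f n)" for n using int' by simp
      show "AE t in M. summable (\<lambda>n. norm (?f n t))"
        using bound' by (intro AE_I2 summable_comparison_test'[OF sum_c]) auto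
      have "(\<integral>t. norm (?f n t) \<partial>M) \<le> (\<integral>t. norm (?c n) * norm (g t) \<partial>M)" for n
        by (intro integral_mono bound' integrable_norm integrable_mult_right int' g)
      then have "(\<integral>t. norm (?f n t) \<partial>M) \<le> norm (?c n) * (\<integral>t. norm (g t) \<partial>M)" for n by simp
      then show "summable (\<lambda>n. \<integral>t. norm (?f n t) \<partial>M)"
        by (intro summable_comparison_test'[OF sum_c]) auto
    qed
    moreover have "(\<Sum>n. ?f n t) = g t * (1 - z * of_real t) powr (- a)" if "t \<in> space M" for t
    proof -
      have "norm z * \<bar>t\<bar> \<le> norm z" using that by (auto simp: space_M intro: mult_left_le)
      then have "norm (z * of_real t) < 1" using z by (simp add: norm_mult)
      from sums_mult[OF sums_one_minus_powr[OF this, of a], of "g t"]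
      show ?thesis by (intro sums_unique[symmetric]) (simp add: power_mult_distrib mult_ac)
    qed
    ultimately show ?thesis by (simp cong: Bochner_Integration.integral_cong)
  qed
qed

section \<open>Identification with the extended hypergeometric function\<close>

text \<open>This makes every extended beta value in the series a moment of one fixed function, as
  the termwise expansion requires.\<close>

lemma ext_beta_integrand_add_of_nat:
  assumes "t > 0"
  shows "ext_beta_integrand \<Theta> b d (\<alpha> + of_nat n) \<beta> t =
           of_real t ^ n * ext_beta_integrand \<Theta> b d \<alpha> \<beta> t"
  using assms powr_add[of "of_real t" "\<alpha> - 1" "of_nat n"] powr_nat[of "of_real t" n]
  by (simp add: ext_beta_integrand_def algebra_simps)

lemma euler_integrand_eq:
  "euler_integrand \<Theta> \<alpha>1 \<alpha>2 \<beta>1 b d z t =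
     ext_beta_integrand \<Theta> b d \<alpha>2 (\<beta>1 - \<alpha>2) t * (1 - z * of_real t) powr (- \<alpha>1)"
  by (simp add: euler_integrand_def ext_beta_integrand_def)

text \<open>By the identity theorem, functions analytic on the connected open cut plane that agree
  on the unit disk agree everywhere on it. So any holomorphic extension of the series is the one
  selected by the definition.\<close>

lemma ext_2F1_eqI:
  assumes f: "f holomorphic_on cut_plane"
    and series: "\<And>\<zeta>. norm \<zeta> < 1 \<Longrightarrow> f \<zeta> = ext_2F1_series \<Theta> \<alpha>1 \<alpha>2 \<beta>1 b d \<zeta>"
    and z: "z \<in> cut_plane"
  shows "ext_2F1 \<Theta> \<alpha>1 \<alpha>2 \<beta>1 b d z = f z"
proof -
  have unique: "h z = f z"
    if "h analytic_on cut_plane"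
      "\<And>\<zeta>. norm \<zeta> < 1 \<Longrightarrow> h \<zeta> = ext_2F1_series \<Theta> \<alpha>1 \<alpha>2 \<beta>1 b d \<zeta>" for h
    by (rule analytic_continuation_open[of "ball 0 1" cut_plane])
      (use that f z series open_cut_plane connected_cut_plane unit_ball_subset_cut_plane
        in \<open>auto simp: analytic_imp_holomorphic\<close>)
  have "f analytic_on cut_plane"
    using f open_cut_plane by (simp add: analytic_on_open)
  \<comment> \<open>\<open>f\<close> itself witnesses existence, and \<open>unique\<close> forces
    every other witness to take the same value at \<open>z\<close>.\<close>
  then have "(THE w. \<exists>h. h analytic_on cut_plane \<and>
      (\<forall>\<zeta>. norm \<zeta> < 1 \<longrightarrow> h \<zeta> = ext_2F1_series \<Theta> \<alpha>1 \<alpha>2 \<beta>1 b d \<zeta>) \<and> w = h z) = f z"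
    by (intro the_equality) (use series unique in blast)+
  then show ?thesis
    using series[of z] unfolding ext_2F1_def by presburger
qed

theorem theorem1p1:
  fixes \<kappa> :: "nat \<Rightarrow> complex" and \<Theta> :: "complex \<Rightarrow> complex" and E :: "complex \<Rightarrow> complex"
    and R M\<^sub>0 :: real and \<omega> :: complex
    and \<alpha>1 \<alpha>2 \<beta>1 b d :: complex
  assumes "\<kappa> 0 = 1"
    and "R > 0"
    and "\<And>z. norm z < R \<Longrightarrow> (\<lambda>l. \<kappa> l * z ^ l / fact l) sums \<Theta> z"
    and "\<Theta> analytic_on (ball 0 R \<union> {z. Re z > 0})"
    and "M\<^sub>0 > 0"
    and "E \<in> O[filtercomap Re at_top](\<lambda>z. 1 / z)"
    and "\<forall>\<^sub>F z in filtercomap Re at_top. \<Theta> z = of_real M\<^sub>0 * z powr \<omega> * exp z * (1 + E z)"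
    and "continuous_on {z. Re z \<le> 0} \<Theta>"
    and "Re \<beta>1 > Re \<alpha>2" and "Re \<alpha>2 > 0"
    and "(Re b > 0 \<and> Re d > 0) \<or> (b = 0 \<and> d = 0)"
    and "\<And>n. set_integrable lborel {0<..<1} (ext_beta_integrand \<Theta> b d (\<alpha>2 + of_nat n) (\<beta>1 - \<alpha>2))"
  shows "(\<forall>z. norm z < 1 \<longrightarrow> summable (ext_2F1_term \<Theta> \<alpha>1 \<alpha>2 \<beta>1 b d z)) \<and>
    ext_2F1 \<Theta> \<alpha>1 \<alpha>2 \<beta>1 b d analytic_on cut_plane \<and>
    (\<forall>z\<in>cut_plane.
      set_integrable lborel {0<..<1} (euler_integrand \<Theta> \<alpha>1 \<alpha>2 \<beta>1 b d z) \<and>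
      ext_2F1 \<Theta> \<alpha>1 \<alpha>2 \<beta>1 b d z =
        1 / Beta \<alpha>2 (\<beta>1 - \<alpha>2) * (LBINT t:{0<..<1}. euler_integrand \<Theta> \<alpha>1 \<alpha>2 \<beta>1 b d z t))"
proof -
  let ?M = "restrict_space lborel {0<..<1 :: real}"
  let ?g = "ext_beta_integrand \<Theta> b d \<alpha>2 (\<beta>1 - \<alpha>2)"
  let ?F = "\<lambda>z. \<integral>t. ?g t * (1 - z * of_real t) powr (- \<alpha>1) \<partial>?M"
  let ?f = "\<lambda>z. 1 / Beta \<alpha>2 (\<beta>1 - \<alpha>2) * ?F z"
  \<comment> \<open>Set integrals over (0,1) become integrals over the restricted measure, the
    setting of the kernel lemmas.\<close>
  have set_integrable_iff: "set_integrable lborel {0<..<1} h \<longleftrightarrow> integrable ?M h"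
    and set_integral_eq: "(LBINT t:{0<..<1}. h t) = integral\<^sup>L ?M h" for h :: "real \<Rightarrow> complex"
    by (simp_all add: set_integrable_def set_lebesgue_integral_def
        integrable_restrict_space integral_restrict_space)
  have g: "integrable ?M ?g"
    using assms(12)[of 0] by (simp add: set_integrable_iff)
  have "ext_beta \<Theta> b d (\<alpha>2 + of_nat n) (\<beta>1 - \<alpha>2) = (\<integral>t. of_real t ^ n * ?g t \<partial>?M)" for n
    unfolding ext_beta_def set_integral_eq
    by (rule Bochner_Integration.integral_cong)
      (auto simp: space_restrict_space ext_beta_integrand_add_of_nat)
  then have term_eq: "ext_2F1_term \<Theta> \<alpha>1 \<alpha>2 \<beta>1 b d z n = 1 / Beta \<alpha>2 (\<beta>1 - \<alpha>2) *
      (pochhammer \<alpha>1 n / fact n * z ^ n * (\<integral>t. of_real t ^ n * ?g t \<partial>?M))" for z n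
    by (simp add: ext_2F1_term_def)
  have sums: "ext_2F1_term \<Theta> \<alpha>1 \<alpha>2 \<beta>1 b d z sums ?f z" if "norm z < 1" for z
    using sums_mult[OF sums_euler_integral[OF g that, of \<alpha>1], of "1 / Beta \<alpha>2 (\<beta>1 - \<alpha>2)"]
    unfolding term_eq[abs_def] .
  have f: "?f holomorphic_on cut_plane"
    by (intro holomorphic_intros holomorphic_on_euler_integral g)
  \<comment> \<open>On the unit disk \<open>sums\<close> identifies the Euler integral with the
    series; \<open>ext_2F1_eqI\<close> carries the equality to the whole cut plane, and with it the
    holomorphy of \<open>?f\<close>.\<close>
  have eq: "ext_2F1 \<Theta> \<alpha>1 \<alpha>2 \<beta>1 b d z = ?f z" if "z \<in> cut_plane" for z
    by (rule ext_2F1_eqI[OF f _ that]) (use sums in \<open>simp add: ext_2F1_series_def sums_unique\<close>)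
  have "ext_2F1 \<Theta> \<alpha>1 \<alpha>2 \<beta>1 b d holomorphic_on cut_plane"
    using f eq by (subst holomorphic_cong[OF refl]) auto
  then have "ext_2F1 \<Theta> \<alpha>1 \<alpha>2 \<beta>1 b d analytic_on cut_plane"
    by (simp add: analytic_on_open open_cut_plane)
  moreover have "set_integrable lborel {0<..<1} (euler_integrand \<Theta> \<alpha>1 \<alpha>2 \<beta>1 b d z)"
    if "z \<in> cut_plane" for z
    unfolding set_integrable_iff euler_integrand_eq[abs_def]
    by (rule integrable_mult_euler_kernel[OF g that])
  ultimately show ?thesis
    using sums eq unfolding set_integral_eq euler_integrand_eq[abs_def]
    by (blast intro: sums_summable)
qed

end
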